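(* Let $F=\frac1n\sum_{i=1}^nF_i$, where each $F_i:\mathbb{R}^d\to\mathbb{R}^d$ is $L_i$-Lipschitz ($L_i>0$) and satisfies $\langle F_i(x)-F_i(x^* ),x-x^*\rangle\ge\mu_i\|x-x^*\|^2$ for all $x$, with (possibly negative) $\mu_i\in\mathbb{R}$, $|\mu_i|\le L_i$. Assume $\overline\mu=\frac1n\sum_{i:\mu_i\ge0}\mu_i+\frac4n\sum_{i:\mu_i<0}\mu_i\ge0$. Let $\xi^k$ be sampled uniformly from $\{1,\dots,n\}$, let $\gamma_{2,\xi^k}=\alpha\gamma_{1,\xi^k}$ with $0<\alpha<1$, and $\gamma_{1,\xi^k}=\gamma$ with $0<\gamma\le\frac{1}{6L_{\max}}$, $L_{\max}=\max_iL_i$. Let $\sigma_{US*}^2=\frac1n\sum_{i=1}^n\|F_i(x^* )\|^2$. Then $g^k=F_{\xi^k}(x^k-\gamma_{1,\xi^k}F_{\xi^k}(x^k))$, with stepsize $\gamma_{2,\xi^k}$, satisfies the unified assumption (see context) with $$A=2\alpha,\quad C=0,\quad D_1=6\alpha^2\gamma^2\sigma_{US*}^2,\quad\rho=\frac{\alpha\gamma\overline\mu}{2},$$ $$G_k=\frac{\alpha\gamma^2}{n}\sum_{i=1}^n\left(1-4|\mu_i|\gamma-2L_i^2\gamma^2\right)\|F_i(x^k)\|^2,\quad B=\frac12,\quad D_2=\frac{3\alpha\gamma^2}{2}\sigma_{US*}^2.$$ If additionally $\alpha\le\frac14$, then for all $K\ge0$: in the case $\overline\mu>0$, $$\mathbb{E}\left[\|x^{K+1}-x^*\|^2\right]\le\left(1-\frac{\alpha\gamma\overline\mu}{2}\right)\mathbb{E}\left[\|x^K-x^*\|^2\right]+\frac{3\alpha}{2}(4\alpha+1)\gamma^2\sigma_{US*}^2,$$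 $$\mathbb{E}\left[\|x^K-x^*\|^2\right]\le\left(1-\frac{\alpha\gamma\overline\mu}{2}\right)^K\|x^0-x^*\|^2+\frac{3(4\alpha+1)\gamma\sigma_{US*}^2}{\overline\mu};$$ and in the case $\overline\mu=0$, $$\frac{1}{K+1}\sum_{k=0}^K\mathbb{E}\left[\frac1n\sum_{i=1}^n\left(1-4|\mu_i|\gamma-2L_i^2\gamma^2\right)\|F_i(x^k)\|^2\right]\le\frac{2\|x^0-x^*\|^2}{\alpha\gamma^2(K+1)}+3(4\alpha+1)\sigma_{US*}^2.$$
   Context: $x^*\in\mathbb{R}^d$ satisfies $F(x^* )=0$, $\|\cdot\|$ is the Euclidean norm. The samples $\xi^0,\xi^1,\dots$ are independent; $\mathbb{E}_{\xi^k}$ is the expectation over $\xi^k$ only (conditional on $x^k$). Same-sample stochastic extragradient (S-SEG), started at a deterministic $x^0$, is $x^{k+1}=x^k-\gamma_{2,\xi^k}F_{\xi^k}(x^k-\gamma_{1,\xi^k}F_{\xi^k}(x^k))$, $k\ge0$. Unified assumption for a method $x^{k+1}=x^k-\gamma_{\xi^k}g^k$ with parameters $A,B,C,D_1,D_2\ge0$, $\rho\in[0,1]$ and non-negative $G_k$: with $P_k=\mathbb{E}_{\xi^k}[\gamma_{\xi^k}\langle g^k,x^k-x^*\rangle]$, for all $k\ge 0$, $$\mathbb{E}_{\xi^k}[\gamma_{\xi^k}^2\|g^k\|^2]\le2AP_k+C\|x^k-x^*\|^2+D_1,\qquad P_k\ge\rho\|x^k-x^*\|^2+BG_k-D_2.$$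 Here $\gamma_{\xi^k}=\gamma_{2,\xi^k}$. *)

theory Defs
  imports "HOL-Probability.Probability"
begin

definition mean_op :: "nat \<Rightarrow> (nat \<Rightarrow> 'a \<Rightarrow> 'a) \<Rightarrow> 'a \<Rightarrow> 'a::real_vector" where
  "mean_op n F x = (1 / real n) *\<^sub>R (\<Sum>i=1..n. F i x)"

definition mu_bar :: "nat \<Rightarrow> (nat \<Rightarrow> real) \<Rightarrow> real" where
  "mu_bar n \<mu> = 1 / real n * (\<Sum>i\<in>{i \<in> {1..n}. \<mu> i \<ge> 0}. \<mu> i)
              + 4 / real n * (\<Sum>i\<in>{i \<in> {1..n}. \<mu> i < 0}. \<mu> i)"

definition sigma2_US :: "nat \<Rightarrow> (nat \<Rightarrow> 'a \<Rightarrow> 'a) \<Rightarrow> 'a::real_normed_vector \<Rightarrow> real" where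
  "sigma2_US n F xs = 1 / real n * (\<Sum>i=1..n. (norm (F i xs))\<^sup>2)"

definition eg_oracle :: "('i \<Rightarrow> 'a \<Rightarrow> 'a) \<Rightarrow> ('i \<Rightarrow> real) \<Rightarrow> 'i \<Rightarrow> 'a \<Rightarrow> 'a::real_vector" where
  "eg_oracle F \<gamma>1 i x = F i (x - \<gamma>1 i *\<^sub>R F i x)"

primrec sseg :: "('i \<Rightarrow> 'a \<Rightarrow> 'a) \<Rightarrow> ('i \<Rightarrow> real) \<Rightarrow> ('i \<Rightarrow> real) \<Rightarrow> 'a
    \<Rightarrow> (nat \<Rightarrow> 'w \<Rightarrow> 'i) \<Rightarrow> nat \<Rightarrow> 'w \<Rightarrow> 'a::real_vector" where
  "sseg F \<gamma>1 \<gamma>2 x0 \<xi> 0 \<omega> = x0"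
| "sseg F \<gamma>1 \<gamma>2 x0 \<xi> (Suc k) \<omega> = sseg F \<gamma>1 \<gamma>2 x0 \<xi> k \<omega>
     - \<gamma>2 (\<xi> k \<omega>) *\<^sub>R eg_oracle F \<gamma>1 (\<xi> k \<omega>) (sseg F \<gamma>1 \<gamma>2 x0 \<xi> k \<omega>)"

definition cond_exp_given :: "'w measure \<Rightarrow> ('w \<Rightarrow> 'a::topological_space) \<Rightarrow> ('w \<Rightarrow> real) \<Rightarrow> 'w \<Rightarrow> real" where
  "cond_exp_given M X Y = real_cond_exp M (vimage_algebra (space M) X borel) Y"

text \<open>In \<open>unified_assumption\<close>, \<open>st k\<close> and \<open>g k\<close> are the random stepsize and the random direction of
  step \<open>k\<close>.  The expectation over the fresh sample alone is the conditional expectation given the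
  current iterate, so the two inequalities hold almost surely.  The measurability and integrability
  clauses are there because \<open>real_cond_exp\<close> is a conditional expectation only for integrable
  arguments; without them the inequalities could hold by accident.\<close>

definition unified_assumption ::
  "'w measure \<Rightarrow> (nat \<Rightarrow> 'w \<Rightarrow> 'a::euclidean_space) \<Rightarrow> (nat \<Rightarrow> 'w \<Rightarrow> real) \<Rightarrow> (nat \<Rightarrow> 'w \<Rightarrow> 'a) \<Rightarrow> 'a
    \<Rightarrow> real \<Rightarrow> real \<Rightarrow> real \<Rightarrow> real \<Rightarrow> real \<Rightarrow> real \<Rightarrow> (nat \<Rightarrow> 'w \<Rightarrow> real) \<Rightarrow> bool" where
  "unified_assumption M x st g xs A B C D1 D2 \<rho> G \<longleftrightarrow>
     A \<ge> 0 \<and> B \<ge> 0 \<and> C \<ge> 0 \<and> D1 \<ge> 0 \<and> D2 \<ge> 0 \<and> 0 \<le> \<rho> \<and> \<rho> \<le> 1 \<and>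
     (\<forall>k. \<forall>\<omega>\<in>space M. G k \<omega> \<ge> 0) \<and>
     (\<forall>k. \<forall>\<omega>\<in>space M. x (Suc k) \<omega> = x k \<omega> - st k \<omega> *\<^sub>R g k \<omega>) \<and>
     (\<forall>k. x k \<in> borel_measurable M \<and>
          integrable M (\<lambda>\<omega>. (st k \<omega>)\<^sup>2 * (norm (g k \<omega>))\<^sup>2) \<and>
          integrable M (\<lambda>\<omega>. st k \<omega> * (g k \<omega> \<bullet> (x k \<omega> - xs)))) \<and>
     (\<forall>k. let P = cond_exp_given M (x k) (\<lambda>\<omega>. st k \<omega> * (g k \<omega> \<bullet> (x k \<omega> - xs))) in
        (AE \<omega> in M. cond_exp_given M (x k) (\<lambda>\<omega>. (st k \<omega>)\<^sup>2 * (norm (g k \<omega>))\<^sup>2) \<omega>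
            \<le> 2 * A * P \<omega> + C * (norm (x k \<omega> - xs))\<^sup>2 + D1) \<and>
        (AE \<omega> in M. P \<omega> \<ge> \<rho> * (norm (x k \<omega> - xs))\<^sup>2 + B * G k \<omega> - D2))"

end

theory Submission
  imports Defs
begin

text \<open>
  The theorem reduces to inequalities about a single operator \<open>T = F i\<close> at a fixed point \<open>x\<close>.  Write
  \<open>a = T x\<close>, \<open>y = x - \<gamma> a\<close>, \<open>g = T y\<close>, \<open>e = T xs\<close> and split
  \<open>\<langle>g - e, x - xs\<rangle> = \<langle>g - e, y - xs\<rangle> + \<gamma> \<langle>g - e, a\<rangle>\<close>.  Quasi-monotonicity at \<open>y\<close> bounds the
  first term by \<open>\<mu> \<parallel>y - xs\<parallel>\<^sup>2\<close>.  Replacing \<open>\<parallel>y - xs\<parallel>\<^sup>2\<close> by \<open>\<parallel>x - xs\<parallel>\<^sup>2\<close> costs a factor \<open>1/2\<close> if \<open>\<mu> \<ge> 0\<close> and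
  a factor \<open>2\<close> if \<open>\<mu> < 0\<close> (and a multiple of \<open>\<gamma>\<^sup>2 \<parallel>a\<parallel>\<^sup>2\<close>); twice these factors are the weights \<open>1\<close> and \<open>4\<close> in \<open>mu_bar\<close>.  In the second term,
  \<open>2\<langle>g, a\<rangle> = \<parallel>g\<parallel>\<^sup>2 + \<parallel>a\<parallel>\<^sup>2 - \<parallel>g - a\<parallel>\<^sup>2\<close> with \<open>\<parallel>g - a\<parallel> \<le> L \<gamma> \<parallel>a\<parallel>\<close>.  The result is
  \<open>extrapolation_lower_bound\<close>.  Young's inequality for \<open>\<langle>e, a\<rangle>\<close> and \<open>\<parallel>g\<parallel> \<ge> 5/6 \<parallel>a\<parallel>\<close> turn it into a
  bound on the second moment, a lower bound on the progress, and a descent inequality.  All three survive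
  averaging over \<open>i\<close>; since the \<open>F i xs\<close> sum to zero, \<open>g - e\<close> may be replaced by \<open>g\<close> in the
  averaged inner product.

  The iterate \<open>x k\<close> is a function of the first \<open>k\<close> samples, hence independent of the sample \<open>\<xi> k\<close>, so that
  conditioning a function of \<open>(\<xi> k, x k)\<close> on \<open>x k\<close> averages it over the index
  (\<open>cond_exp_given_indep_uniform\<close>).  It takes finitely many values, so everything is integrable.

  The rates do not follow from the two unified inequalities with the constant \<open>D1 + D2\<close>: eliminating the
  second moment from the expansion of \<open>\<parallel>x (k + 1) - xs\<parallel>\<^sup>2\<close> leaves \<open>2 (1 - A) P\<close> with \<open>1 \<le> 2 (1 - A) < 2\<close>, and as \<open>P\<close>
  may be negative, its lower bound then enters with \<open>2 (1 - A) D2\<close> instead of \<open>D2\<close>.  The descent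
  inequality \<open>extrapolated_descent\<close> is therefore derived directly from \<open>extrapolation_lower_bound\<close>, whose
  term \<open>\<parallel>g\<parallel>\<^sup>2\<close> still has enough slack when \<open>\<alpha> \<le> 1/4\<close>.  What remains is to unroll the
  recursion geometrically or to telescope it.
\<close>

section \<open>One extrapolation step of one operator\<close>

text \<open>The factor in front of \<open>\<parallel>x - xs\<parallel>\<^sup>2\<close> comes from \<open>\<parallel>d\<parallel>\<^sup>2 / 2 - \<parallel>\<gamma> a\<parallel>\<^sup>2 \<le> \<parallel>d - \<gamma> a\<parallel>\<^sup>2 \<le> 2 \<parallel>d\<parallel>\<^sup>2 + 2 \<parallel>\<gamma> a\<parallel>\<^sup>2\<close>
  with \<open>d = x - xs\<close>, of which the first half is used for \<open>m \<ge> 0\<close> and the second for \<open>m < 0\<close>.  The term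
  \<open>\<parallel>T (x - \<gamma> T x)\<parallel>\<^sup>2\<close> is kept because each of the later bounds spends it differently.\<close>

lemma extrapolation_lower_bound:
  fixes T :: "'a::real_inner \<Rightarrow> 'a"
  assumes lip: "L-lipschitz_on UNIV T"
    and qm: "\<And>y. (T y - T xs) \<bullet> (y - xs) \<ge> m * (norm (y - xs))\<^sup>2"
    and "0 < \<gamma>"
  shows "(T (x - \<gamma> *\<^sub>R T x) - T xs) \<bullet> (x - xs)
      \<ge> (if m \<ge> 0 then m else 4 * m) / 2 * (norm (x - xs))\<^sup>2
        + \<gamma> / 2 * ((norm (T (x - \<gamma> *\<^sub>R T x)))\<^sup>2
            + (1 - 4 * \<bar>m\<bar> * \<gamma> - L\<^sup>2 * \<gamma>\<^sup>2) * (norm (T x))\<^sup>2 - 2 * (T xs \<bullet> T x))"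
proof -
  define a where "a = T x"
  define y where "y = x - \<gamma> *\<^sub>R a"
  define g where "g = T y"
  define e where "e = T xs"
  define d where "d = x - xs"
  have y: "y - xs = d - \<gamma> *\<^sub>R a" by (simp add: y_def d_def)
  have "norm (g - a) \<le> L * norm (y - x)"
    using lipschitz_onD[OF lip, of y x] by (simp add: g_def a_def dist_norm)
  also have "\<dots> = L * \<gamma> * norm a" using \<open>0 < \<gamma>\<close> by (simp add: y_def)
  finally have "(norm (g - a))\<^sup>2 \<le> (L * \<gamma> * norm a)\<^sup>2" by (rule power_mono) simp
  then have ga: "2 * (g \<bullet> a) \<ge> (norm g)\<^sup>2 + (norm a)\<^sup>2 - L\<^sup>2 * \<gamma>\<^sup>2 * (norm a)\<^sup>2"
    by (simp add: power2_norm_eq_inner inner_diff inner_commute power_mult_distrib)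
  \<comment> \<open>Each identity has one square that is dropped: the first then bounds \<open>\<parallel>d - \<gamma> a\<parallel>\<^sup>2\<close> from above, the second from below.\<close>
  have para: "(norm (d - \<gamma> *\<^sub>R a))\<^sup>2 + (norm (d + \<gamma> *\<^sub>R a))\<^sup>2 = 2 * (norm d)\<^sup>2 + 2 * \<gamma>\<^sup>2 * (norm a)\<^sup>2"
    unfolding power2_norm_eq_inner
    by (simp add: inner_diff inner_add inner_commute power2_eq_square algebra_simps)
  have para2: "(norm (d - 2 *\<^sub>R (\<gamma> *\<^sub>R a)))\<^sup>2
      = 2 * (norm (d - \<gamma> *\<^sub>R a))\<^sup>2 - (norm d)\<^sup>2 + 2 * (\<gamma>\<^sup>2 * (norm a)\<^sup>2)"
    unfolding power2_norm_eq_inner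
    by (simp add: inner_diff inner_commute power2_eq_square algebra_simps)
  have "m * (norm (d - \<gamma> *\<^sub>R a))\<^sup>2
      \<ge> (if m \<ge> 0 then m else 4 * m) / 2 * (norm d)\<^sup>2 - 2 * \<bar>m\<bar> * \<gamma>\<^sup>2 * (norm a)\<^sup>2"
  proof (cases "m \<ge> 0")
    case True
    have "m * (norm d)\<^sup>2 / 2 - m * (\<gamma>\<^sup>2 * (norm a)\<^sup>2) \<le> m * (norm (d - \<gamma> *\<^sub>R a))\<^sup>2"
      using mult_left_mono[OF _ True, of "(norm d)\<^sup>2 / 2 - \<gamma>\<^sup>2 * (norm a)\<^sup>2" "(norm (d - \<gamma> *\<^sub>R a))\<^sup>2"]
        para2 zero_le_power2[of "norm (d - 2 *\<^sub>R (\<gamma> *\<^sub>R a))"]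
      by (simp add: right_diff_distrib del: zero_le_power2)
    moreover have "0 \<le> m * (\<gamma>\<^sup>2 * (norm a)\<^sup>2)" using True by simp
    ultimately show ?thesis using True by (simp add: mult.assoc, linarith)
  next
    case False
    have "(norm (d - \<gamma> *\<^sub>R a))\<^sup>2 \<le> 2 * (norm d)\<^sup>2 + 2 * \<gamma>\<^sup>2 * (norm a)\<^sup>2"
      using para zero_le_power2[of "norm (d + \<gamma> *\<^sub>R a)"] by linarith
    from mult_left_mono_neg[OF this, of m] False show ?thesis
      by (simp add: algebra_simps)
  qed
  with qm[of y] have "(g - e) \<bullet> (d - \<gamma> *\<^sub>R a)
      \<ge> (if m \<ge> 0 then m else 4 * m) / 2 * (norm d)\<^sup>2 - 2 * \<bar>m\<bar> * \<gamma>\<^sup>2 * (norm a)\<^sup>2"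
    unfolding y g_def e_def by linarith
  moreover have "(g - e) \<bullet> d = (g - e) \<bullet> (d - \<gamma> *\<^sub>R a) + \<gamma> / 2 * (2 * (g \<bullet> a) - 2 * (e \<bullet> a))"
    by (simp add: inner_diff algebra_simps)
  moreover have "\<gamma> / 2 * (2 * (g \<bullet> a) - 2 * (e \<bullet> a))
      \<ge> \<gamma> / 2 * ((norm g)\<^sup>2 + (norm a)\<^sup>2 - L\<^sup>2 * \<gamma>\<^sup>2 * (norm a)\<^sup>2 - 2 * (e \<bullet> a))"
    using ga \<open>0 < \<gamma>\<close> by (intro mult_left_mono) auto
  ultimately have "(g - e) \<bullet> d \<ge> (if m \<ge> 0 then m else 4 * m) / 2 * (norm d)\<^sup>2
      + \<gamma> / 2 * ((norm g)\<^sup>2 + (1 - 4 * \<bar>m\<bar> * \<gamma> - L\<^sup>2 * \<gamma>\<^sup>2) * (norm a)\<^sup>2 - 2 * (e \<bullet> a))"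
    by (simp add: algebra_simps power2_eq_square)
  then show ?thesis by (simp add: g_def e_def d_def a_def y_def)
qed

lemma extrapolated_norm_lower_bound:
  fixes T :: "'a::real_inner \<Rightarrow> 'a"
  assumes lip: "L-lipschitz_on UNIV T" and "0 < \<gamma>" and "L * \<gamma> \<le> 1 / 6"
  shows "(norm (T (x - \<gamma> *\<^sub>R T x)))\<^sup>2 \<ge> 25 / 36 * (norm (T x))\<^sup>2"
proof -
  have "norm (T (x - \<gamma> *\<^sub>R T x) - T x) \<le> L * \<gamma> * norm (T x)"
    using lipschitz_onD[OF lip, of "x - \<gamma> *\<^sub>R T x" x] \<open>0 < \<gamma>\<close> by (simp add: dist_norm)
  also have "\<dots> \<le> 1 / 6 * norm (T x)" using assms(3) by (intro mult_right_mono) auto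
  finally have "norm (T (x - \<gamma> *\<^sub>R T x)) \<ge> 5 / 6 * norm (T x)"
    using norm_triangle_ineq2[of "T x" "T (x - \<gamma> *\<^sub>R T x)"] by (simp add: norm_minus_commute)
  then have "(norm (T (x - \<gamma> *\<^sub>R T x)))\<^sup>2 \<ge> (5 / 6 * norm (T x))\<^sup>2" by (rule power_mono) simp
  then show ?thesis by (simp add: power_mult_distrib power2_eq_square)
qed

lemma young_inner:
  fixes u v :: "'a::real_inner"
  assumes "0 < s"
  shows "2 * (u \<bullet> v) \<le> s * (norm u)\<^sup>2 + (norm v)\<^sup>2 / s"
proof -
  have "s * (2 * (u \<bullet> v)) \<le> s * (s * (norm u)\<^sup>2 + (norm v)\<^sup>2 / s)"
    using zero_le_power2[of "norm (s *\<^sub>R u - v)"] assms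
    by (simp add: power2_norm_eq_inner inner_diff inner_commute algebra_simps del: zero_le_power2)
  with assms show ?thesis by simp
qed

text \<open>The worst case is \<open>L \<gamma> = \<bar>m\<bar> \<gamma> = 1/6\<close>.  The parameter of Young's inequality is fixed by the admissible
  multiple of \<open>\<parallel>T xs\<parallel>\<^sup>2\<close>, and the margin is small: in the descent inequality \<open>2 \<langle>T xs, T x\<rangle>\<close> costs \<open>2/3 \<parallel>T x\<parallel>\<^sup>2\<close>, while
  \<open>(3/4) (25/36) + 1/6 = 11/16\<close> is available.\<close>
lemma
  fixes T :: "'a::real_inner \<Rightarrow> 'a" and x :: 'a
  assumes lip: "L-lipschitz_on UNIV T"
    and qm: "\<And>y. (T y - T xs) \<bullet> (y - xs) \<ge> m * (norm (y - xs))\<^sup>2"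
    and gam: "0 < \<gamma>" "L * \<gamma> \<le> 1 / 6" and mL: "\<bar>m\<bar> \<le> L"
  defines "g \<equiv> T (x - \<gamma> *\<^sub>R T x)"
    and "\<kappa> \<equiv> (if m \<ge> 0 then m else 4 * m)"
    and "c \<equiv> 1 - 4 * \<bar>m\<bar> * \<gamma> - 2 * L\<^sup>2 * \<gamma>\<^sup>2"
  shows extrapolated_second_moment:
      "\<gamma> * (norm g)\<^sup>2 + 2 * \<kappa> * (norm (x - xs))\<^sup>2 \<le> 4 * ((g - T xs) \<bullet> (x - xs)) + 6 * \<gamma> * (norm (T xs))\<^sup>2"
    and extrapolated_progress:
      "(g - T xs) \<bullet> (x - xs) \<ge> \<kappa> / 2 * (norm (x - xs))\<^sup>2 + \<gamma> / 2 * (c * (norm (T x))\<^sup>2)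
         - 3 * \<gamma> / 2 * (norm (T xs))\<^sup>2"
    and extrapolated_descent: "\<alpha> \<le> 1 / 4 \<Longrightarrow> 0 < \<alpha> \<Longrightarrow>
      2 * ((g - T xs) \<bullet> (x - xs)) - \<alpha> * \<gamma> * (norm g)\<^sup>2
        \<ge> \<kappa> * (norm (x - xs))\<^sup>2 + \<gamma> / 2 * (c * (norm (T x))\<^sup>2)
           - 3 / 2 * (4 * \<alpha> + 1) * \<gamma> * (norm (T xs))\<^sup>2"
    and extrapolated_weight_nonneg: "c \<ge> 0"
proof -
  define A E Gn D ip where "A = (norm (T x))\<^sup>2" and "E = (norm (T xs))\<^sup>2" and "Gn = (norm g)\<^sup>2"
    and "D = (norm (x - xs))\<^sup>2" and "ip = (g - T xs) \<bullet> (x - xs)"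
  note ab = A_def[symmetric] E_def[symmetric] Gn_def[symmetric] D_def[symmetric] ip_def[symmetric]
  define q where "q = L\<^sup>2 * \<gamma>\<^sup>2"
  define r where "r = \<bar>m\<bar> * \<gamma>"
  have "0 \<le> L" using mL by simp
  have r: "0 \<le> r" "r \<le> 1 / 6"
    using gam mult_right_mono[OF mL, of \<gamma>] unfolding r_def by (simp, linarith)
  have q0: "0 \<le> q" by (simp add: q_def)
  have "(L * \<gamma>)\<^sup>2 \<le> (1 / 6)\<^sup>2" using gam \<open>0 \<le> L\<close> by (intro power_mono) auto
  then have q: "q \<le> 1 / 36" by (simp add: q_def power_mult_distrib) (simp add: power2_eq_square)
  have c: "c = 1 - 4 * r - 2 * q" by (simp add: c_def r_def q_def)
  show "c \<ge> 0" using r q c by simp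
  have nn: "A \<ge> 0" "E \<ge> 0" "D \<ge> 0" "Gn \<ge> 0" by (auto simp: A_def E_def D_def Gn_def)
  have GA: "Gn \<ge> 25 / 36 * A"
    using extrapolated_norm_lower_bound[OF lip gam, of x] by (simp add: Gn_def A_def g_def)
  have Y: "2 * (T xs \<bullet> T x) \<le> s * E + A / s" if "0 < s" for s
    using young_inner[OF that, of "T xs" "T x"] by (simp add: E_def A_def)
  define W where "W = Gn + (1 - 4 * r - q) * A - 2 * (T xs \<bullet> T x)"
  have core: "ip \<ge> \<kappa> / 2 * D + \<gamma> / 2 * W"
    using extrapolation_lower_bound[OF lip qm gam(1), of x]
    by (simp only: W_def ip_def D_def A_def Gn_def g_def \<kappa>_def r_def q_def mult.assoc)
  note rA = mult_right_mono[OF r(2) nn(1)] mult_nonneg_nonneg[OF r(1) nn(1)]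
  note qA = mult_right_mono[OF q nn(1)] mult_nonneg_nonneg[OF q0 nn(1)]
  have "\<gamma> * (Gn - 6 * E) \<le> \<gamma> * (2 * W)"
    unfolding W_def using gam GA Y[of 3] rA qA nn by (intro mult_left_mono) (auto simp: algebra_simps)
  then show "\<gamma> * (norm g)\<^sup>2 + 2 * \<kappa> * (norm (x - xs))\<^sup>2 \<le> 4 * ((g - T xs) \<bullet> (x - xs)) + 6 * \<gamma> * (norm (T xs))\<^sup>2"
    unfolding ab using core by (simp add: algebra_simps)
  have "\<gamma> / 2 * (c * A - 3 * E) \<le> \<gamma> / 2 * W"
    unfolding c W_def using gam GA Y[of 3] rA qA nn by (intro mult_left_mono) (auto simp: algebra_simps)
  then show "(g - T xs) \<bullet> (x - xs) \<ge> \<kappa> / 2 * (norm (x - xs))\<^sup>2 + \<gamma> / 2 * (c * (norm (T x))\<^sup>2)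
         - 3 * \<gamma> / 2 * (norm (T xs))\<^sup>2"
    unfolding ab using core by (simp add: algebra_simps)
  assume al: "\<alpha> \<le> 1 / 4" "0 < \<alpha>"
  have "\<alpha> * Gn \<le> 1 / 4 * Gn" using al(1) nn(4) by (rule mult_right_mono)
  moreover have "0 \<le> \<alpha> * E" using al nn by simp
  ultimately have "\<gamma> * (c * A / 2 - 3 / 2 * (4 * \<alpha> + 1) * E)
      \<le> \<gamma> * (W - \<alpha> * Gn)"
    unfolding c W_def using gam GA Y[of "3/2"] rA qA nn by (intro mult_left_mono) (auto simp: algebra_simps add_divide_distrib diff_divide_distrib)
  then show "2 * ((g - T xs) \<bullet> (x - xs)) - \<alpha> * \<gamma> * (norm g)\<^sup>2
        \<ge> \<kappa> * (norm (x - xs))\<^sup>2 + \<gamma> / 2 * (c * (norm (T x))\<^sup>2)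
           - 3 / 2 * (4 * \<alpha> + 1) * \<gamma> * (norm (T xs))\<^sup>2"
    unfolding ab using core by (simp add: algebra_simps)
qed

section \<open>Averaging over the operators\<close>

lemma mu_bar_eq_average: "mu_bar n \<mu> = 1 / real n * (\<Sum>i=1..n. if \<mu> i \<ge> 0 then \<mu> i else 4 * \<mu> i)"
proof -
  have "(\<Sum>i=1..n. if \<mu> i \<ge> 0 then \<mu> i else 4 * \<mu> i)
      = sum \<mu> ({1..n} \<inter> {i. \<mu> i \<ge> 0}) + (\<Sum>i\<in>{1..n} \<inter> - {i. \<mu> i \<ge> 0}. 4 * \<mu> i)"
    by (rule sum.If_cases) simp
  also have "{1..n} \<inter> {i. \<mu> i \<ge> 0} = {i \<in> {1..n}. \<mu> i \<ge> 0}" by auto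
  also have "{1..n} \<inter> - {i. \<mu> i \<ge> 0} = {i \<in> {1..n}. \<mu> i < 0}" by auto
  finally show ?thesis
    by (simp add: mu_bar_def sum_distrib_left distrib_left)
qed

text \<open>The average of \<open>F i xs\<close> vanishes, so the inner products \<open>\<langle>F i xs, x - xs\<rangle>\<close> cancel; that a single
  \<open>F i\<close> need not vanish at \<open>xs\<close> is visible only in the variance \<open>sigma2_US\<close>.\<close>
lemma
  fixes F :: "nat \<Rightarrow> 'a::real_inner \<Rightarrow> 'a" and x :: 'a
  assumes n: "n \<ge> 1" and sol: "mean_op n F xs = 0"
    and lip: "\<And>i. i \<in> {1..n} \<Longrightarrow> (L i)-lipschitz_on UNIV (F i)"
    and qm: "\<And>i y. i \<in> {1..n} \<Longrightarrow> (F i y - F i xs) \<bullet> (y - xs) \<ge> \<mu> i * (norm (y - xs))\<^sup>2"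
    and gam: "0 < \<gamma>" "\<And>i. i \<in> {1..n} \<Longrightarrow> L i * \<gamma> \<le> 1 / 6"
    and mL: "\<And>i. i \<in> {1..n} \<Longrightarrow> \<bar>\<mu> i\<bar> \<le> L i"
  defines "avg \<equiv> (\<lambda>h. 1 / real n * (\<Sum>i=1..n. h i))"
    and "g \<equiv> (\<lambda>i. F i (x - \<gamma> *\<^sub>R F i x))"
    and "c \<equiv> (\<lambda>i. 1 - 4 * \<bar>\<mu> i\<bar> * \<gamma> - 2 * (L i)\<^sup>2 * \<gamma>\<^sup>2)"
  shows average_second_moment:
      "\<gamma> * avg (\<lambda>i. (norm (g i))\<^sup>2) + 2 * mu_bar n \<mu> * (norm (x - xs))\<^sup>2
        \<le> 4 * avg (\<lambda>i. g i \<bullet> (x - xs)) + 6 * \<gamma> * sigma2_US n F xs"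
    and average_progress:
      "avg (\<lambda>i. g i \<bullet> (x - xs)) \<ge> mu_bar n \<mu> / 2 * (norm (x - xs))\<^sup>2
         + \<gamma> / 2 * avg (\<lambda>i. c i * (norm (F i x))\<^sup>2) - 3 * \<gamma> / 2 * sigma2_US n F xs"
    and average_descent: "0 < \<alpha> \<Longrightarrow> \<alpha> \<le> 1 / 4 \<Longrightarrow>
      2 * avg (\<lambda>i. g i \<bullet> (x - xs)) - \<alpha> * \<gamma> * avg (\<lambda>i. (norm (g i))\<^sup>2)
        \<ge> mu_bar n \<mu> * (norm (x - xs))\<^sup>2 + \<gamma> / 2 * avg (\<lambda>i. c i * (norm (F i x))\<^sup>2)
           - 3 / 2 * (4 * \<alpha> + 1) * \<gamma> * sigma2_US n F xs"
proof -
  define \<kappa> where "\<kappa> = (\<lambda>i. if \<mu> i \<ge> 0 then \<mu> i else 4 * \<mu> i)"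
  have mono: "avg h \<le> avg h'" if "\<And>i. i \<in> {1..n} \<Longrightarrow> h i \<le> h' i" for h h' :: "nat \<Rightarrow> real"
    unfolding avg_def using that by (intro mult_left_mono sum_mono) auto
  have lin: "avg (\<lambda>i. h i + h' i) = avg h + avg h'" "avg (\<lambda>i. h i - h' i) = avg h - avg h'"
    "avg (\<lambda>i. r * h i) = r * avg h" "avg (\<lambda>i. h i * r) = avg h * r" for h h' :: "nat \<Rightarrow> real" and r
    by (simp_all add: avg_def sum.distrib sum_subtractf add_divide_distrib diff_divide_distrib
        sum_distrib_left[symmetric] sum_distrib_right[symmetric])
  have \<kappa>: "avg \<kappa> = mu_bar n \<mu>" by (simp add: avg_def \<kappa>_def mu_bar_eq_average)
  have \<sigma>: "avg (\<lambda>i. (norm (F i xs))\<^sup>2) = sigma2_US n F xs" by (simp add: avg_def sigma2_US_def)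
  have "(\<Sum>i=1..n. F i xs) = 0" using sol n by (simp add: mean_op_def)
  then have "(\<Sum>i=1..n. (g i - F i xs) \<bullet> (x - xs)) = (\<Sum>i=1..n. g i \<bullet> (x - xs))"
    by (simp add: inner_sum_left[symmetric] sum_subtractf)
  then have ip: "avg (\<lambda>i. (g i - F i xs) \<bullet> (x - xs)) = avg (\<lambda>i. g i \<bullet> (x - xs))"
    by (simp add: avg_def)
  have "avg (\<lambda>i. \<gamma> * (norm (g i))\<^sup>2 + 2 * \<kappa> i * (norm (x - xs))\<^sup>2)
      \<le> avg (\<lambda>i. 4 * ((g i - F i xs) \<bullet> (x - xs)) + 6 * \<gamma> * (norm (F i xs))\<^sup>2)"
    unfolding g_def \<kappa>_def using lip qm gam mL by (intro mono extrapolated_second_moment) auto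
  then show "\<gamma> * avg (\<lambda>i. (norm (g i))\<^sup>2) + 2 * mu_bar n \<mu> * (norm (x - xs))\<^sup>2
        \<le> 4 * avg (\<lambda>i. g i \<bullet> (x - xs)) + 6 * \<gamma> * sigma2_US n F xs"
    by (simp only: lin \<kappa> \<sigma> ip)
  have "avg (\<lambda>i. (g i - F i xs) \<bullet> (x - xs)) \<ge> avg (\<lambda>i. 1 / 2 * \<kappa> i * (norm (x - xs))\<^sup>2
         + \<gamma> / 2 * (c i * (norm (F i x))\<^sup>2) - 3 * \<gamma> / 2 * (norm (F i xs))\<^sup>2)"
  proof (rule mono)
    fix i assume "i \<in> {1..n}"
    then have "\<kappa> i / 2 * (norm (x - xs))\<^sup>2
         + \<gamma> / 2 * (c i * (norm (F i x))\<^sup>2) - 3 * \<gamma> / 2 * (norm (F i xs))\<^sup>2 \<le> (g i - F i xs) \<bullet> (x - xs)"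
      unfolding g_def \<kappa>_def c_def using lip qm gam mL by (intro extrapolated_progress) auto
    then show "1 / 2 * \<kappa> i * (norm (x - xs))\<^sup>2
         + \<gamma> / 2 * (c i * (norm (F i x))\<^sup>2) - 3 * \<gamma> / 2 * (norm (F i xs))\<^sup>2 \<le> (g i - F i xs) \<bullet> (x - xs)"
      by simp
  qed
  then show "avg (\<lambda>i. g i \<bullet> (x - xs)) \<ge> mu_bar n \<mu> / 2 * (norm (x - xs))\<^sup>2
         + \<gamma> / 2 * avg (\<lambda>i. c i * (norm (F i x))\<^sup>2) - 3 * \<gamma> / 2 * sigma2_US n F xs"
    by (simp only: lin \<kappa> \<sigma> ip)
  assume al: "0 < \<alpha>" "\<alpha> \<le> 1 / 4"
  have "avg (\<lambda>i. 2 * ((g i - F i xs) \<bullet> (x - xs)) - \<alpha> * \<gamma> * (norm (g i))\<^sup>2)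
    \<ge> avg (\<lambda>i. \<kappa> i * (norm (x - xs))\<^sup>2 + \<gamma> / 2 * (c i * (norm (F i x))\<^sup>2)
           - 3 / 2 * (4 * \<alpha> + 1) * \<gamma> * (norm (F i xs))\<^sup>2)"
    unfolding g_def \<kappa>_def c_def using lip qm gam mL al by (intro mono extrapolated_descent) auto
  then show "2 * avg (\<lambda>i. g i \<bullet> (x - xs)) - \<alpha> * \<gamma> * avg (\<lambda>i. (norm (g i))\<^sup>2)
        \<ge> mu_bar n \<mu> * (norm (x - xs))\<^sup>2 + \<gamma> / 2 * avg (\<lambda>i. c i * (norm (F i x))\<^sup>2)
           - 3 / 2 * (4 * \<alpha> + 1) * \<gamma> * sigma2_US n F xs"
    by (simp only: lin \<kappa> \<sigma> ip)
qed

section \<open>Averaging over a fresh uniform sample\<close>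

text \<open>Independence of \<open>X\<close> and \<open>\<xi>\<close> is expressed through real-valued functions of each, because \<open>indep_var\<close>
  requires both variables to have the same type.  Splitting along the events \<open>\<xi> = i\<close> writes the
  integrand as a sum of products to which independence applies.\<close>
lemma (in prob_space)
  fixes X :: "'a \<Rightarrow> 'b::topological_space" and \<psi> :: "nat \<Rightarrow> 'b \<Rightarrow> real"
  assumes X[measurable]: "X \<in> borel_measurable M" and \<xi>[measurable]: "\<xi> \<in> M \<rightarrow>\<^sub>M count_space {1..n}"
    and ind: "\<And>f i. f \<in> borel_measurable borel \<Longrightarrow> i \<in> {1..n} \<Longrightarrow>
      indep_var borel (\<lambda>\<omega>. f (X \<omega>) :: real) borel (\<lambda>\<omega>. indicator {i} (\<xi> \<omega>) :: real)"
    and unif: "distr M (count_space {1..n}) \<xi> = uniform_count_measure {1..n}"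
    and \<psi>: "\<And>i. i \<in> {1..n} \<Longrightarrow> \<psi> i \<in> borel_measurable borel"
    and int: "\<And>i. i \<in> {1..n} \<Longrightarrow> integrable M (\<lambda>\<omega>. \<psi> i (X \<omega>))"
  shows integrable_indep_uniform: "integrable M (\<lambda>\<omega>. \<psi> (\<xi> \<omega>) (X \<omega>))"
    and expectation_indep_uniform:
      "expectation (\<lambda>\<omega>. \<psi> (\<xi> \<omega>) (X \<omega>)) = expectation (\<lambda>\<omega>. 1 / real n * (\<Sum>i=1..n. \<psi> i (X \<omega>)))"
proof -
  have decomp: "\<psi> (\<xi> \<omega>) (X \<omega>) = (\<Sum>i=1..n. \<psi> i (X \<omega>) * indicator {i} (\<xi> \<omega>))"
    if "\<omega> \<in> space M" for \<omega>
  proof -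
    have "\<xi> \<omega> \<in> {1..n}" using measurable_space[OF \<xi> that] by simp
    then show ?thesis
      by (subst sum.remove[of _ "\<xi> \<omega>"]) (auto intro!: sum.neutral simp: indicator_def)
  qed
  have summand: "integrable M (\<lambda>\<omega>. \<psi> i (X \<omega>) * indicator {i} (\<xi> \<omega>))"
     "expectation (\<lambda>\<omega>. \<psi> i (X \<omega>) * indicator {i} (\<xi> \<omega>)) = expectation (\<lambda>\<omega>. \<psi> i (X \<omega>)) * (1 / real n)"
    if i: "i \<in> {1..n}" for i
  proof -
    note iv = ind[OF \<psi>[OF i] i]
    have i2: "integrable M (\<lambda>\<omega>. indicator {i} (\<xi> \<omega>) :: real)"
      by (rule integrable_const_bound[where B=1]) (auto simp: indicator_def)
    show "integrable M (\<lambda>\<omega>. \<psi> i (X \<omega>) * indicator {i} (\<xi> \<omega>))"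
      by (rule indep_var_integrable[OF iv int[OF i] i2])
    have "(\<integral>\<omega>. indicator {i} (\<xi> \<omega>) \<partial>M)
        = (\<integral>j. indicator {i} j \<partial>distr M (count_space {1..n}) \<xi> :: real)"
      by (rule integral_distr[symmetric, OF \<xi>]) simp
    also have "\<dots> = 1 / real n"
      unfolding unif using i by (simp add: measure_uniform_count_measure space_uniform_count_measure)
    finally show "expectation (\<lambda>\<omega>. \<psi> i (X \<omega>) * indicator {i} (\<xi> \<omega>)) = expectation (\<lambda>\<omega>. \<psi> i (X \<omega>)) * (1 / real n)"
      by (simp add: indep_var_lebesgue_integral[OF iv int[OF i] i2])
  qed
  have "integrable M (\<lambda>\<omega>. \<Sum>i=1..n. \<psi> i (X \<omega>) * indicator {i} (\<xi> \<omega>))"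
    by (intro Bochner_Integration.integrable_sum summand)
  then show "integrable M (\<lambda>\<omega>. \<psi> (\<xi> \<omega>) (X \<omega>))"
    by (simp only: Bochner_Integration.integrable_cong[OF refl decomp])
  have "expectation (\<lambda>\<omega>. \<psi> (\<xi> \<omega>) (X \<omega>)) = expectation (\<lambda>\<omega>. \<Sum>i=1..n. \<psi> i (X \<omega>) * indicator {i} (\<xi> \<omega>))"
    by (rule Bochner_Integration.integral_cong[OF refl decomp])
  also have "\<dots> = (\<Sum>i=1..n. expectation (\<lambda>\<omega>. \<psi> i (X \<omega>)) * (1 / real n))"
    by (simp only: Bochner_Integration.integral_sum summand cong: sum.cong)
  also have "\<dots> = expectation (\<lambda>\<omega>. 1 / real n * (\<Sum>i=1..n. \<psi> i (X \<omega>)))"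
    using int by (simp add: Bochner_Integration.integral_sum sum_divide_distrib)
  finally show "expectation (\<lambda>\<omega>. \<psi> (\<xi> \<omega>) (X \<omega>)) = expectation (\<lambda>\<omega>. 1 / real n * (\<Sum>i=1..n. \<psi> i (X \<omega>)))" .
qed

text \<open>An event generated by \<open>X\<close> has the form \<open>X -` B\<close>, and its indicator can be absorbed into the
  integrand; the defining property of the conditional expectation is then the previous lemma for
  \<open>indicator B \<cdot> \<psi> i\<close>.\<close>
lemma (in prob_space) cond_exp_given_indep_uniform:
  fixes X :: "'a \<Rightarrow> 'b::topological_space" and \<psi> :: "nat \<Rightarrow> 'b \<Rightarrow> real"
  assumes X[measurable]: "X \<in> borel_measurable M" and \<xi>[measurable]: "\<xi> \<in> M \<rightarrow>\<^sub>M count_space {1..n}"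
    and ind: "\<And>f i. f \<in> borel_measurable borel \<Longrightarrow> i \<in> {1..n} \<Longrightarrow>
      indep_var borel (\<lambda>\<omega>. f (X \<omega>) :: real) borel (\<lambda>\<omega>. indicator {i} (\<xi> \<omega>) :: real)"
    and unif: "distr M (count_space {1..n}) \<xi> = uniform_count_measure {1..n}"
    and \<psi>: "\<And>i. i \<in> {1..n} \<Longrightarrow> \<psi> i \<in> borel_measurable borel"
    and int: "\<And>i. i \<in> {1..n} \<Longrightarrow> integrable M (\<lambda>\<omega>. \<psi> i (X \<omega>))"
  shows "AE \<omega> in M. cond_exp_given M X (\<lambda>\<omega>. \<psi> (\<xi> \<omega>) (X \<omega>)) \<omega> = 1 / real n * (\<Sum>i=1..n. \<psi> i (X \<omega>))"
proof -
  let ?F = "vimage_algebra (space M) X borel"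
  have sF: "sets ?F = {X -` B \<inter> space M |B. B \<in> sets borel}"
    by (rule sets_vimage_algebra2) auto
  have "subalgebra M ?F"
    by (auto simp: subalgebra_def sF)
  then interpret S: finite_measure_subalgebra M ?F
    by unfold_locales
  show ?thesis
    unfolding cond_exp_given_def
  proof (rule S.real_cond_exp_charact)
    show "integrable M (\<lambda>\<omega>. \<psi> (\<xi> \<omega>) (X \<omega>))"
      by (rule integrable_indep_uniform[OF X \<xi> ind unif \<psi> int])
    show "integrable M (\<lambda>\<omega>. 1 / real n * (\<Sum>i=1..n. \<psi> i (X \<omega>)))"
      by (intro integrable_mult_right Bochner_Integration.integrable_sum int)
    have "X \<in> borel_measurable ?F" by (rule measurable_vimage_algebra1) simp
    then show "(\<lambda>\<omega>. 1 / real n * (\<Sum>i=1..n. \<psi> i (X \<omega>))) \<in> borel_measurable ?F"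
      by (intro borel_measurable_times borel_measurable_const borel_measurable_sum)
         (rule measurable_compose[OF _ \<psi>])
  next
    fix A assume "A \<in> sets ?F"
    then obtain B where B[measurable]: "B \<in> sets borel" and A: "A = X -` B \<inter> space M"
      by (auto simp: sF)
    have ind_A: "indicator A \<omega> = (indicator B (X \<omega>) :: real)" if "\<omega> \<in> space M" for \<omega>
      using that by (simp add: A indicator_def)
    have "(\<integral>\<omega>\<in>A. \<psi> (\<xi> \<omega>) (X \<omega>) \<partial>M) = expectation (\<lambda>\<omega>. indicator B (X \<omega>) * \<psi> (\<xi> \<omega>) (X \<omega>))"
      unfolding set_lebesgue_integral_def
      by (rule Bochner_Integration.integral_cong) (auto simp: ind_A)
    also have "\<dots> = expectation (\<lambda>\<omega>. 1 / real n * (\<Sum>i=1..n. indicator B (X \<omega>) * \<psi> i (X \<omega>)))"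
    proof (rule expectation_indep_uniform[OF X \<xi> ind unif, of "\<lambda>i z. indicator B z * \<psi> i z"])
      fix i assume i: "i \<in> {1..n}"
      have [measurable]: "\<psi> i \<in> borel_measurable borel" by (rule \<psi>[OF i])
      show "(\<lambda>z. indicator B z * \<psi> i z) \<in> borel_measurable borel" by measurable
      show "integrable M (\<lambda>\<omega>. indicator B (X \<omega>) * \<psi> i (X \<omega>))"
        by (rule Bochner_Integration.integrable_bound[OF int[OF i]])
           (auto simp: indicator_def)
    qed
    also have "\<dots> = (\<integral>\<omega>\<in>A. 1 / real n * (\<Sum>i=1..n. \<psi> i (X \<omega>)) \<partial>M)"
      unfolding set_lebesgue_integral_def
      by (rule Bochner_Integration.integral_cong) (auto simp: ind_A sum_distrib_left[symmetric])
    finally show "(\<integral>\<omega>\<in>A. \<psi> (\<xi> \<omega>) (X \<omega>) \<partial>M) = (\<integral>\<omega>\<in>A. 1 / real n * (\<Sum>i=1..n. \<psi> i (X \<omega>)) \<partial>M)" .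
  qed
qed

section \<open>The iterates as functions of the samples\<close>

lemma (in prob_space) integrable_finite_range:
  fixes f :: "'b::topological_space \<Rightarrow> real"
  assumes [measurable]: "X \<in> borel_measurable M" "f \<in> borel_measurable borel" and fin: "finite (X ` space M)"
  shows "integrable M (\<lambda>\<omega>. f (X \<omega>))"
proof (rule integrable_const_bound)
  show "AE \<omega> in M. norm (f (X \<omega>)) \<le> Max ((\<lambda>z. norm (f z)) ` X ` space M)"
    using fin by (auto intro!: AE_I2 Max_ge)
qed measurable

text \<open>Only the samples before \<open>k\<close> are required to be measurable, so that the lemma applies both to the
  probability space and to the finite product of the first \<open>k\<close> sample spaces.\<close>
lemma sseg_measurable:
  fixes F :: "nat \<Rightarrow> 'a::euclidean_space \<Rightarrow> 'a"
  assumes F: "\<And>i. i \<in> {1..n} \<Longrightarrow> F i \<in> borel_measurable borel"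
    and \<xi>: "\<And>j. j < k \<Longrightarrow> \<xi> j \<in> N \<rightarrow>\<^sub>M count_space {1..n}"
  shows "sseg F \<gamma>1 \<gamma>2 x0 \<xi> k \<in> borel_measurable N"
  using \<xi>
proof (induction k)
  case 0
  then show ?case by simp
next
  case (Suc k)
  have [measurable]: "sseg F \<gamma>1 \<gamma>2 x0 \<xi> k \<in> borel_measurable N" 
    by (rule Suc.IH, rule Suc.prems) simp
  have step: "(\<lambda>\<omega>. sseg F \<gamma>1 \<gamma>2 x0 \<xi> k \<omega> - \<gamma>2 i *\<^sub>R eg_oracle F \<gamma>1 i (sseg F \<gamma>1 \<gamma>2 x0 \<xi> k \<omega>))
      \<in> borel_measurable N" if "i \<in> {1..n}" for i
  proof -
    have [measurable]: "F i \<in> borel_measurable borel" by (rule F[OF that])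
    show ?thesis unfolding eg_oracle_def by measurable
  qed
  show ?case
    using measurable_compose_countable'[OF step Suc.prems[OF lessI]] by simp
qed

lemma finite_range_sseg:
  assumes "\<And>j \<omega>. \<omega> \<in> S \<Longrightarrow> \<xi> j \<omega> \<in> {1..n::nat}"
  shows "finite (sseg F \<gamma>1 \<gamma>2 x0 \<xi> k ` S)"
proof (induction k)
  case 0
  have "sseg F \<gamma>1 \<gamma>2 x0 \<xi> 0 ` S \<subseteq> {x0}" by auto
  then show ?case by (rule finite_subset) simp
next
  case (Suc k)
  have "sseg F \<gamma>1 \<gamma>2 x0 \<xi> (Suc k) ` S
      \<subseteq> (\<lambda>(z, i). z - \<gamma>2 i *\<^sub>R eg_oracle F \<gamma>1 i z) ` (sseg F \<gamma>1 \<gamma>2 x0 \<xi> k ` S \<times> {1..n})"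
    using assms by force
  then show ?case by (rule finite_subset) (use Suc in simp)
qed

lemma sseg_cong:
  assumes "\<And>j. j < k \<Longrightarrow> \<xi> j \<omega> = \<xi>' j \<omega>'"
  shows "sseg F \<gamma>1 \<gamma>2 x0 \<xi> k \<omega> = sseg F \<gamma>1 \<gamma>2 x0 \<xi>' k \<omega>'"
  using assms by (induction k) simp_all

text \<open>The recursion run on the coordinate projections exhibits the iterate as a measurable function of
  the first \<open>k\<close> samples, which are jointly independent of the sample \<open>k\<close>.\<close>
lemma (in prob_space) indep_var_sseg:
  fixes F :: "nat \<Rightarrow> 'c::euclidean_space \<Rightarrow> 'c"
  assumes indep: "indep_vars (\<lambda>_. count_space {1..n}) \<xi> UNIV"
    and F: "\<And>i. i \<in> {1..n} \<Longrightarrow> F i \<in> borel_measurable borel"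
    and f: "f \<in> borel_measurable borel" and i: "i \<in> {1..n}"
  shows "indep_var borel (\<lambda>\<omega>. f (sseg F \<gamma>1 \<gamma>2 x0 \<xi> k \<omega>) :: real)
           borel (\<lambda>\<omega>. indicator {i} (\<xi> k \<omega>) :: real)"
proof -
  let ?C = "\<lambda>_::nat. count_space {1..n::nat}"
  let ?h = "sseg F \<gamma>1 \<gamma>2 x0 (\<lambda>j s. s j) k"
  have "indep_var borel ((\<lambda>s. f (?h s)) \<circ> (\<lambda>\<omega>. restrict (\<lambda>i. \<xi> i \<omega>) {..<k}))
      borel ((\<lambda>s. indicator {i} (s k)) \<circ> (\<lambda>\<omega>. restrict (\<lambda>i. \<xi> i \<omega>) {k}))"
  proof (rule indep_var_compose[OF indep_var_restrict[OF indep]])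
    have "?h \<in> borel_measurable (PiM {..<k} ?C)"
      by (rule sseg_measurable[OF F]) (auto intro: measurable_component_singleton)
    then show "(\<lambda>s. f (?h s)) \<in> borel_measurable (PiM {..<k} ?C)"
      by (rule measurable_compose[OF _ f])
    have "(\<lambda>s. s k) \<in> PiM {k} ?C \<rightarrow>\<^sub>M count_space {1..n}"
      by (rule measurable_component_singleton) simp
    then show "(\<lambda>s. indicator {i} (s k) :: real) \<in> borel_measurable (PiM {k} ?C)"
      by (rule measurable_compose) simp
  qed auto
  moreover have "?h (restrict (\<lambda>i. \<xi> i \<omega>) {..<k}) = sseg F \<gamma>1 \<gamma>2 x0 \<xi> k \<omega>" for \<omega>
    by (rule sseg_cong) simp
  ultimately show ?thesis by (simp add: comp_def)
qed

section \<open>Unrolling the recursion\<close>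

lemma geometric_recursion_bound:
  fixes e :: "nat \<Rightarrow> real"
  assumes rec: "\<And>k. e (Suc k) \<le> (1 - \<rho>) * e k + D" and \<rho>: "0 < \<rho>" "\<rho> \<le> 1" and "0 \<le> D"
  shows "e k \<le> (1 - \<rho>) ^ k * e 0 + D / \<rho>"
proof (induction k)
  case 0
  show ?case using \<rho> \<open>0 \<le> D\<close> by simp
next
  case (Suc k)
  have "e (Suc k) \<le> (1 - \<rho>) * ((1 - \<rho>) ^ k * e 0 + D / \<rho>) + D"
    using rec[of k] mult_left_mono[OF Suc, of "1 - \<rho>"] \<rho> by simp
  also have "\<dots> = (1 - \<rho>) ^ Suc k * e 0 + D / \<rho>"
    using \<rho> by (simp add: field_simps)
  finally show ?case .
qed

lemma telescoped_sum_bound: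
  fixes e h :: "nat \<Rightarrow> real"
  assumes rec: "\<And>k. e (Suc k) + h k \<le> e k + D" and "\<And>k. 0 \<le> e k"
  shows "(\<Sum>k=0..K. h k) \<le> e 0 + (real K + 1) * D"
proof -
  have "(\<Sum>k=0..K. h k) + e (Suc K) \<le> e 0 + (real K + 1) * D"
  proof (induction K)
    case 0
    show ?case using rec[of 0] by simp
  next
    case (Suc K)
    show ?case using Suc rec[of "Suc K"] by (simp add: algebra_simps)
  qed
  with assms(2)[of "Suc K"] show ?thesis by linarith
qed

section \<open>Same-sample extragradient with uniform sampling\<close>

theorem theoremE2:
  fixes M :: "'w measure"
    and n :: nat
    and F :: "nat \<Rightarrow> real ^ 'd \<Rightarrow> real ^ 'd"
    and L \<mu> \<gamma>1 \<gamma>2 :: "nat \<Rightarrow> real"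
    and \<alpha> \<gamma> :: real
    and xs x0 :: "real ^ 'd"
    and \<xi> :: "nat \<Rightarrow> 'w \<Rightarrow> nat"
    and x :: "nat \<Rightarrow> 'w \<Rightarrow> real ^ 'd"
  assumes "prob_space M"
    and "n \<ge> 1"
    and sol: "mean_op n F xs = 0"
    and L_pos: "\<And>i. i \<in> {1..n} \<Longrightarrow> L i > 0"
    and lipschitz: "\<And>i. i \<in> {1..n} \<Longrightarrow> (L i)-lipschitz_on UNIV (F i)"
    and quasi_mono: "\<And>i y. i \<in> {1..n} \<Longrightarrow>
          (F i y - F i xs) \<bullet> (y - xs) \<ge> \<mu> i * (norm (y - xs))\<^sup>2"
    and mu_le_L: "\<And>i. i \<in> {1..n} \<Longrightarrow> \<bar>\<mu> i\<bar> \<le> L i"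
    and mu_bar_nonneg: "mu_bar n \<mu> \<ge> 0"
    and indep: "prob_space.indep_vars M (\<lambda>_. count_space {1..n}) \<xi> UNIV"
    and uniform: "\<And>k. distr M (count_space {1..n}) (\<xi> k) = uniform_count_measure {1..n}"
    and alpha: "0 < \<alpha>" "\<alpha> < 1"
    and gamma: "0 < \<gamma>" "\<gamma> \<le> 1 / (6 * Max (L ` {1..n}))"
    and stepsize1: "\<And>i. i \<in> {1..n} \<Longrightarrow> \<gamma>1 i = \<gamma>"
    and stepsize2: "\<And>i. i \<in> {1..n} \<Longrightarrow> \<gamma>2 i = \<alpha> * \<gamma>1 i"
    and iterates: "x = sseg F \<gamma>1 \<gamma>2 x0 \<xi>"
  shows "unified_assumption M x (\<lambda>k \<omega>. \<gamma>2 (\<xi> k \<omega>)) (\<lambda>k \<omega>. eg_oracle F \<gamma>1 (\<xi> k \<omega>) (x k \<omega>)) xs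
           (2 * \<alpha>)
           (1 / 2)
           0
           (6 * \<alpha>\<^sup>2 * \<gamma>\<^sup>2 * sigma2_US n F xs)
           (3 * \<alpha> * \<gamma>\<^sup>2 / 2 * sigma2_US n F xs)
           (\<alpha> * \<gamma> * mu_bar n \<mu> / 2)
           (\<lambda>k \<omega>. \<alpha> * \<gamma>\<^sup>2 / real n *
              (\<Sum>i=1..n. (1 - 4 * \<bar>\<mu> i\<bar> * \<gamma> - 2 * (L i)\<^sup>2 * \<gamma>\<^sup>2) * (norm (F i (x k \<omega>)))\<^sup>2))
       \<and> (\<alpha> \<le> 1 / 4 \<longrightarrow>
           (\<forall>K::nat.
             (mu_bar n \<mu> > 0 \<longrightarrow>
                prob_space.expectation M (\<lambda>\<omega>. (norm (x (K + 1) \<omega> - xs))\<^sup>2)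
                  \<le> (1 - \<alpha> * \<gamma> * mu_bar n \<mu> / 2)
                        * prob_space.expectation M (\<lambda>\<omega>. (norm (x K \<omega> - xs))\<^sup>2)
                     + 3 * \<alpha> / 2 * (4 * \<alpha> + 1) * \<gamma>\<^sup>2 * sigma2_US n F xs
              \<and> prob_space.expectation M (\<lambda>\<omega>. (norm (x K \<omega> - xs))\<^sup>2)
                  \<le> (1 - \<alpha> * \<gamma> * mu_bar n \<mu> / 2) ^ K * (norm (x0 - xs))\<^sup>2
                     + 3 * (4 * \<alpha> + 1) * \<gamma> * sigma2_US n F xs / mu_bar n \<mu>)
           \<and> (mu_bar n \<mu> = 0 \<longrightarrow>
                1 / (real K + 1) * (\<Sum>k=0..K. prob_space.expectation M (\<lambda>\<omega>. 1 / real n *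
                    (\<Sum>i=1..n. (1 - 4 * \<bar>\<mu> i\<bar> * \<gamma> - 2 * (L i)\<^sup>2 * \<gamma>\<^sup>2) * (norm (F i (x k \<omega>)))\<^sup>2)))
                  \<le> 2 * (norm (x0 - xs))\<^sup>2 / (\<alpha> * \<gamma>\<^sup>2 * (real K + 1))
                     + 3 * (4 * \<alpha> + 1) * sigma2_US n F xs)))"
proof -
  interpret prob_space M by fact
  define \<sigma>2 \<mu>b where "\<sigma>2 = sigma2_US n F xs" and "\<mu>b = mu_bar n \<mu>"
  define Lm where "Lm = Max (L ` {1..n})"
  define avg :: "(nat \<Rightarrow> real) \<Rightarrow> real" where "avg h = 1 / real n * (\<Sum>i=1..n. h i)" for h
  define c where "c i = 1 - 4 * \<bar>\<mu> i\<bar> * \<gamma> - 2 * (L i)\<^sup>2 * \<gamma>\<^sup>2" for i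
  define H where "H = (\<lambda>z. avg (\<lambda>i. c i * (norm (F i z))\<^sup>2))"
  define g where "g i z = F i (z - \<gamma> *\<^sub>R F i z)" for i z
  define ip where "ip = (\<lambda>i z. \<gamma>2 i * (eg_oracle F \<gamma>1 i z \<bullet> (z - xs)))"
  define sq where "sq = (\<lambda>i z. (\<gamma>2 i)\<^sup>2 * (norm (eg_oracle F \<gamma>1 i z))\<^sup>2)"
  have \<sigma>2: "0 \<le> \<sigma>2" by (simp add: \<sigma>2_def sigma2_US_def sum_nonneg)

  have L_le: "L i \<le> Lm" if "i \<in> {1..n}" for i
    unfolding Lm_def using that by (intro Max_ge) auto
  have "0 < Lm" using L_le[of 1] L_pos[of 1] \<open>n \<ge> 1\<close> by simp
  then have "\<gamma> * Lm \<le> 1 / 6"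
    using gamma(2) unfolding Lm_def[symmetric] by (simp add: field_simps)
  have L\<gamma>: "L i * \<gamma> \<le> 1 / 6" if "i \<in> {1..n}" for i
    using mult_left_mono[OF L_le[OF that] less_imp_le[OF gamma(1)]] \<open>\<gamma> * Lm \<le> 1 / 6\<close>
    by (simp add: mult.commute[of "L i"])
  have "\<mu>b \<le> avg (\<lambda>_. Lm)"
    unfolding \<mu>b_def mu_bar_eq_average avg_def
  proof (intro mult_left_mono sum_mono)
    fix i assume "i \<in> {1..n}"
    then show "(if 0 \<le> \<mu> i then \<mu> i else 4 * \<mu> i) \<le> Lm"
      using mu_le_L[of i] L_le[of i] by auto
  qed simp
  also have "\<dots> = Lm" using \<open>n \<ge> 1\<close> by (simp add: avg_def)
  finally have "\<gamma> * \<mu>b \<le> 1 / 6"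
    using mult_left_mono[of \<mu>b Lm \<gamma>] gamma(1) \<open>\<gamma> * Lm \<le> 1 / 6\<close> by linarith
  moreover have "\<alpha> * (\<gamma> * \<mu>b) \<le> 1 * (\<gamma> * \<mu>b)"
    using alpha gamma(1) mu_bar_nonneg by (intro mult_right_mono) (auto simp: \<mu>b_def)
  ultimately have \<rho>: "0 \<le> \<alpha> * \<gamma> * \<mu>b / 2" "\<alpha> * \<gamma> * \<mu>b / 2 \<le> 1"
    using alpha gamma(1) mu_bar_nonneg unfolding mult.assoc by (simp add: \<mu>b_def, linarith)
  have avg_lin: "avg (\<lambda>i. h i + h' i) = avg h + avg h'" "avg (\<lambda>i. h i - h' i) = avg h - avg h'"
    "avg (\<lambda>i. r * h i) = r * avg h" "avg (\<lambda>i. r) = r" for h h' :: "nat \<Rightarrow> real" and r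
    using \<open>n \<ge> 1\<close> by (simp_all add: avg_def sum.distrib sum_subtractf add_divide_distrib
        diff_divide_distrib sum_distrib_left[symmetric])
  have avg_cong: "avg h = avg h'" if "\<And>i. i \<in> {1..n} \<Longrightarrow> h i = h' i" for h h'
    unfolding avg_def using that sum.cong[OF refl, of "{1..n}" h h'] by simp

  have c0: "0 \<le> c i" if "i \<in> {1..n}" for i
    unfolding c_def using extrapolated_weight_nonneg[OF lipschitz quasi_mono gamma(1) L\<gamma> mu_le_L]
      that by blast
  have H0: "0 \<le> H z" for z
    unfolding H_def avg_def using c0 by (auto intro!: sum_nonneg mult_nonneg_nonneg divide_nonneg_nonneg)
  have oracle_eq: "eg_oracle F \<gamma>1 i z = g i z" "\<gamma>2 i = \<alpha> * \<gamma>" if "i \<in> {1..n}" for i z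
    using that by (simp_all add: eg_oracle_def g_def stepsize1 stepsize2)
  have avg_ip: "avg (\<lambda>i. ip i z) = \<alpha> * \<gamma> * avg (\<lambda>i. g i z \<bullet> (z - xs))" for z
    unfolding avg_lin(3)[symmetric] by (rule avg_cong) (simp add: ip_def oracle_eq)
  have avg_sq: "avg (\<lambda>i. sq i z) = (\<alpha> * \<gamma>)\<^sup>2 * avg (\<lambda>i. (norm (g i z))\<^sup>2)" for z
    unfolding avg_lin(3)[symmetric] by (rule avg_cong) (simp add: sq_def oracle_eq)
  note bounds = average_second_moment average_progress average_descent
  note bounds = bounds[OF \<open>n \<ge> 1\<close> sol lipschitz quasi_mono gamma(1) L\<gamma> mu_le_L,
      folded avg_def g_def c_def \<sigma>2_def \<mu>b_def]
  have second_moment: "avg (\<lambda>i. sq i z) \<le> 2 * (2 * \<alpha>) * avg (\<lambda>i. ip i z) + 6 * \<alpha>\<^sup>2 * \<gamma>\<^sup>2 * \<sigma>2" for z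
  proof -
    have "0 \<le> 2 * \<mu>b * (norm (z - xs))\<^sup>2" using mu_bar_nonneg by (simp add: \<mu>b_def)
    then have "\<gamma> * avg (\<lambda>i. (norm (g i z))\<^sup>2) \<le> 4 * avg (\<lambda>i. g i z \<bullet> (z - xs)) + 6 * \<gamma> * \<sigma>2"
      using bounds(1)[of z] by linarith
    then have "\<alpha>\<^sup>2 * \<gamma> * (\<gamma> * avg (\<lambda>i. (norm (g i z))\<^sup>2))
        \<le> \<alpha>\<^sup>2 * \<gamma> * (4 * avg (\<lambda>i. g i z \<bullet> (z - xs)) + 6 * \<gamma> * \<sigma>2)"
      using gamma(1) by (intro mult_left_mono) auto
    then show ?thesis
      unfolding avg_ip avg_sq by (simp add: algebra_simps power2_eq_square)
  qed
  have progress: "avg (\<lambda>i. ip i z) \<ge> \<alpha> * \<gamma> * \<mu>b / 2 * (norm (z - xs))\<^sup>2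
      + 1 / 2 * (\<alpha> * \<gamma>\<^sup>2 * H z) - 3 * \<alpha> * \<gamma>\<^sup>2 / 2 * \<sigma>2" for z
    using mult_left_mono[OF bounds(2)[of z], of "\<alpha> * \<gamma>"] alpha gamma(1)
    unfolding avg_ip H_def by (simp add: algebra_simps power2_eq_square)
  have descent: "avg (\<lambda>i. (norm (z - \<gamma>2 i *\<^sub>R eg_oracle F \<gamma>1 i z - xs))\<^sup>2) + 1 / 2 * (\<alpha> * \<gamma>\<^sup>2) * H z
      \<le> (1 - \<alpha> * \<gamma> * \<mu>b / 2) * (norm (z - xs))\<^sup>2 + 3 * \<alpha> / 2 * (4 * \<alpha> + 1) * \<gamma>\<^sup>2 * \<sigma>2"
    if "\<alpha> \<le> 1 / 4" for z
  proof -
    have expand: "(norm (z - \<gamma>2 i *\<^sub>R eg_oracle F \<gamma>1 i z - xs))\<^sup>2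
        = ((norm (z - xs))\<^sup>2 - 2 * ip i z) + sq i z" for i
      unfolding ip_def sq_def power2_norm_eq_inner
      by (simp add: inner_diff inner_commute power2_eq_square algebra_simps)
    define p where "p = avg (\<lambda>i. g i z \<bullet> (z - xs))"
    define s where "s = avg (\<lambda>i. (norm (g i z))\<^sup>2)"
    define d where "d = (norm (z - xs))\<^sup>2"
    have "\<alpha> * \<gamma> * (\<mu>b * d + \<gamma> / 2 * H z - 3 / 2 * (4 * \<alpha> + 1) * \<gamma> * \<sigma>2) \<le> \<alpha> * \<gamma> * (2 * p - \<alpha> * \<gamma> * s)"
      using bounds(3)[of \<alpha> z] alpha gamma(1) that
      unfolding H_def p_def s_def d_def by (intro mult_left_mono) auto
    moreover have "0 \<le> \<alpha> * \<gamma> * \<mu>b / 2 * d" using \<rho> by (intro mult_nonneg_nonneg) (auto simp: d_def)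
    moreover have "avg (\<lambda>i. (norm (z - \<gamma>2 i *\<^sub>R eg_oracle F \<gamma>1 i z - xs))\<^sup>2)
        = d - 2 * (\<alpha> * \<gamma> * p) + (\<alpha> * \<gamma>)\<^sup>2 * s"
      unfolding expand avg_lin avg_ip avg_sq p_def s_def d_def ..
    ultimately show ?thesis
      unfolding d_def[symmetric] by (simp add: algebra_simps power2_eq_square add_divide_distrib)
  qed

  have \<xi>_meas [measurable]: "\<xi> k \<in> M \<rightarrow>\<^sub>M count_space {1..n}" for k
    using indep unfolding indep_vars_def by blast
  have F_meas: "F i \<in> borel_measurable borel" if "i \<in> {1..n}" for i
    using lipschitz_on_continuous_on[OF lipschitz[OF that]] by (rule borel_measurable_continuous_onI)
  have x_meas [measurable]: "x k \<in> borel_measurable M" for k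
    unfolding iterates by (rule sseg_measurable[OF F_meas \<xi>_meas])
  have "\<xi> j \<omega> \<in> {1..n}" if "\<omega> \<in> space M" for j \<omega>
    using measurable_space[OF \<xi>_meas that] by simp
  then have x_fin: "finite (x k ` space M)" for k
    unfolding iterates by (rule finite_range_sseg)
  note x_int = integrable_finite_range[OF x_meas _ x_fin]
  have x_indep: "indep_var borel (\<lambda>\<omega>. f (x k \<omega>) :: real) borel (\<lambda>\<omega>. indicator {i} (\<xi> k \<omega>) :: real)"
    if "f \<in> borel_measurable borel" "i \<in> {1..n}" for f i k
    unfolding iterates using that by (intro indep_var_sseg[OF indep F_meas])
  note fresh = x_meas \<xi>_meas x_indep uniform

  have orc_meas [measurable]: "eg_oracle F \<gamma>1 i \<in> borel_measurable borel" if "i \<in> {1..n}" for i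
  proof -
    note F_meas[OF that, measurable]
    show ?thesis unfolding eg_oracle_def by measurable
  qed
  have ip_meas: "ip i \<in> borel_measurable borel" and sq_meas: "sq i \<in> borel_measurable borel"
    and step_meas: "(\<lambda>z. (norm (z - \<gamma>2 i *\<^sub>R eg_oracle F \<gamma>1 i z - xs))\<^sup>2) \<in> borel_measurable borel"
    if "i \<in> {1..n}" for i
  proof -
    note orc_meas[OF that, measurable]
    show "ip i \<in> borel_measurable borel" "sq i \<in> borel_measurable borel"
      "(\<lambda>z. (norm (z - \<gamma>2 i *\<^sub>R eg_oracle F \<gamma>1 i z - xs))\<^sup>2) \<in> borel_measurable borel"
      unfolding ip_def sq_def by measurable
  qed
  note ip_int = x_int[OF ip_meas] and sq_int = x_int[OF sq_meas] and step_int = x_int[OF step_meas]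
  have H_meas: "H \<in> borel_measurable borel"
    unfolding H_def avg_def
  proof (intro borel_measurable_times borel_measurable_const borel_measurable_sum)
    fix i assume "i \<in> {1..n}"
    note F_meas[OF this, measurable]
    show "(\<lambda>z. (norm (F i z))\<^sup>2) \<in> borel_measurable borel" by measurable
  qed

  have unified: "unified_assumption M x (\<lambda>k \<omega>. \<gamma>2 (\<xi> k \<omega>)) (\<lambda>k \<omega>. eg_oracle F \<gamma>1 (\<xi> k \<omega>) (x k \<omega>)) xs
      (2 * \<alpha>) (1 / 2) 0 (6 * \<alpha>\<^sup>2 * \<gamma>\<^sup>2 * \<sigma>2) (3 * \<alpha> * \<gamma>\<^sup>2 / 2 * \<sigma>2) (\<alpha> * \<gamma> * \<mu>b / 2)
      (\<lambda>k \<omega>. \<alpha> * \<gamma>\<^sup>2 * H (x k \<omega>))"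
    unfolding unified_assumption_def Let_def
  proof (intro conjI allI ballI)
    fix k
    show "x k \<in> borel_measurable M" by (rule x_meas)
    have ce_ip: "AE \<omega> in M. cond_exp_given M (x k) (\<lambda>\<omega>. ip (\<xi> k \<omega>) (x k \<omega>)) \<omega> = avg (\<lambda>i. ip i (x k \<omega>))"
      unfolding avg_def by (rule cond_exp_given_indep_uniform[OF fresh]) (simp_all only: ip_meas ip_int)
    have ce_sq: "AE \<omega> in M. cond_exp_given M (x k) (\<lambda>\<omega>. sq (\<xi> k \<omega>) (x k \<omega>)) \<omega> = avg (\<lambda>i. sq i (x k \<omega>))"
      unfolding avg_def by (rule cond_exp_given_indep_uniform[OF fresh]) (simp_all only: sq_meas sq_int)
    show "AE \<omega> in M. cond_exp_given M (x k)
          (\<lambda>\<omega>. (\<gamma>2 (\<xi> k \<omega>))\<^sup>2 * (norm (eg_oracle F \<gamma>1 (\<xi> k \<omega>) (x k \<omega>)))\<^sup>2) \<omega>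
        \<le> 2 * (2 * \<alpha>) * cond_exp_given M (x k)
            (\<lambda>\<omega>. \<gamma>2 (\<xi> k \<omega>) * (eg_oracle F \<gamma>1 (\<xi> k \<omega>) (x k \<omega>) \<bullet> (x k \<omega> - xs))) \<omega>
          + 0 * (norm (x k \<omega> - xs))\<^sup>2 + 6 * \<alpha>\<^sup>2 * \<gamma>\<^sup>2 * \<sigma>2"
      using ce_ip ce_sq
    proof eventually_elim
      case (elim \<omega>)
      with second_moment[of "x k \<omega>"] show ?case unfolding ip_def sq_def by simp
    qed
    show "AE \<omega> in M. cond_exp_given M (x k)
            (\<lambda>\<omega>. \<gamma>2 (\<xi> k \<omega>) * (eg_oracle F \<gamma>1 (\<xi> k \<omega>) (x k \<omega>) \<bullet> (x k \<omega> - xs))) \<omega>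
        \<ge> \<alpha> * \<gamma> * \<mu>b / 2 * (norm (x k \<omega> - xs))\<^sup>2 + 1 / 2 * (\<alpha> * \<gamma>\<^sup>2 * H (x k \<omega>))
          - 3 * \<alpha> * \<gamma>\<^sup>2 / 2 * \<sigma>2"
      using ce_ip
    proof eventually_elim
      case (elim \<omega>)
      with progress[of "x k \<omega>"] show ?case unfolding ip_def by simp
    qed
    have "integrable M (\<lambda>\<omega>. sq (\<xi> k \<omega>) (x k \<omega>))" "integrable M (\<lambda>\<omega>. ip (\<xi> k \<omega>) (x k \<omega>))"
      by (rule integrable_indep_uniform[OF fresh]; simp only: ip_meas sq_meas ip_int sq_int)+
    then show "integrable M (\<lambda>\<omega>. (\<gamma>2 (\<xi> k \<omega>))\<^sup>2 * (norm (eg_oracle F \<gamma>1 (\<xi> k \<omega>) (x k \<omega>)))\<^sup>2)"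
      "integrable M (\<lambda>\<omega>. \<gamma>2 (\<xi> k \<omega>) * (eg_oracle F \<gamma>1 (\<xi> k \<omega>) (x k \<omega>) \<bullet> (x k \<omega> - xs)))"
      unfolding ip_def sq_def .
  qed (use alpha gamma(1) \<sigma>2 \<rho> H0 in \<open>auto simp: iterates\<close>)

  define e where "e k = expectation (\<lambda>\<omega>. (norm (x k \<omega> - xs))\<^sup>2)" for k
  define h where "h k = expectation (\<lambda>\<omega>. H (x k \<omega>))" for k
  have e0: "0 \<le> e k" for k unfolding e_def by simp
  have e_start: "e 0 = (norm (x0 - xs))\<^sup>2" by (simp add: e_def iterates prob_space)
  have h0: "0 \<le> h k" for k unfolding h_def using H0 by simp
  have int_e: "integrable M (\<lambda>\<omega>. (norm (x k \<omega> - xs))\<^sup>2)" for k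
    by (rule x_int[of "\<lambda>z. (norm (z - xs))\<^sup>2"]) measurable
  have int_h: "integrable M (\<lambda>\<omega>. H (x k \<omega>))" for k
    by (rule x_int[OF H_meas])
  have step: "e (Suc k) + 1 / 2 * (\<alpha> * \<gamma>\<^sup>2) * h k
      \<le> (1 - \<alpha> * \<gamma> * \<mu>b / 2) * e k + 3 * \<alpha> / 2 * (4 * \<alpha> + 1) * \<gamma>\<^sup>2 * \<sigma>2" if "\<alpha> \<le> 1 / 4" for k
  proof -
    let ?s = "\<lambda>i z. (norm (z - \<gamma>2 i *\<^sub>R eg_oracle F \<gamma>1 i z - xs))\<^sup>2"
    have "e (Suc k) = expectation (\<lambda>\<omega>. ?s (\<xi> k \<omega>) (x k \<omega>))"
      by (simp add: e_def iterates)
    also have "\<dots> = expectation (\<lambda>\<omega>. avg (\<lambda>i. ?s i (x k \<omega>)))"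
      unfolding avg_def by (rule expectation_indep_uniform[OF fresh, where \<psi> = ?s]) (simp_all only: step_meas step_int)
    finally have "e (Suc k) + 1 / 2 * (\<alpha> * \<gamma>\<^sup>2) * h k
        = expectation (\<lambda>\<omega>. avg (\<lambda>i. ?s i (x k \<omega>))) + expectation (\<lambda>\<omega>. 1 / 2 * (\<alpha> * \<gamma>\<^sup>2) * H (x k \<omega>))"
      by (simp add: h_def)
    also have "\<dots> = expectation (\<lambda>\<omega>. avg (\<lambda>i. ?s i (x k \<omega>)) + 1 / 2 * (\<alpha> * \<gamma>\<^sup>2) * H (x k \<omega>))"
      unfolding avg_def
      by (intro Bochner_Integration.integral_add[symmetric] integrable_mult_right
          Bochner_Integration.integrable_sum step_int int_h)
    also have "\<dots> \<le> expectation (\<lambda>\<omega>. (1 - \<alpha> * \<gamma> * \<mu>b / 2) * (norm (x k \<omega> - xs))\<^sup>2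
        + 3 * \<alpha> / 2 * (4 * \<alpha> + 1) * \<gamma>\<^sup>2 * \<sigma>2)"
    proof (rule integral_mono)
      show "integrable M (\<lambda>\<omega>. avg (\<lambda>i. ?s i (x k \<omega>)) + 1 / 2 * (\<alpha> * \<gamma>\<^sup>2) * H (x k \<omega>))"
        unfolding avg_def
        by (intro Bochner_Integration.integrable_add integrable_mult_right
            Bochner_Integration.integrable_sum step_int int_h)
    qed (use int_e descent[OF that] in auto)
    also have "\<dots> = (1 - \<alpha> * \<gamma> * \<mu>b / 2) * e k + 3 * \<alpha> / 2 * (4 * \<alpha> + 1) * \<gamma>\<^sup>2 * \<sigma>2"
      using int_e by (simp add: e_def prob_space)
    finally show ?thesis .
  qed
  have D: "0 \<le> 3 * \<alpha> / 2 * (4 * \<alpha> + 1) * \<gamma>\<^sup>2 * \<sigma>2" using alpha \<sigma>2 by simp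
  have rec: "e (Suc k) \<le> (1 - \<alpha> * \<gamma> * \<mu>b / 2) * e k + 3 * \<alpha> / 2 * (4 * \<alpha> + 1) * \<gamma>\<^sup>2 * \<sigma>2"
    if "\<alpha> \<le> 1 / 4" for k
  proof -
    have "0 \<le> 1 / 2 * (\<alpha> * \<gamma>\<^sup>2) * h k" using alpha h0 by simp
    with step[OF that, of k] show ?thesis by linarith
  qed
  have linear: "e K \<le> (1 - \<alpha> * \<gamma> * \<mu>b / 2) ^ K * (norm (x0 - xs))\<^sup>2 + 3 * (4 * \<alpha> + 1) * \<gamma> * \<sigma>2 / \<mu>b"
    if "\<alpha> \<le> 1 / 4" "\<mu>b > 0" for K
  proof -
    have "e K \<le> (1 - \<alpha> * \<gamma> * \<mu>b / 2) ^ K * e 0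
        + (3 * \<alpha> / 2 * (4 * \<alpha> + 1) * \<gamma>\<^sup>2 * \<sigma>2) / (\<alpha> * \<gamma> * \<mu>b / 2)"
      by (rule geometric_recursion_bound[where e = e, OF rec[OF that(1)] _ \<rho>(2) D]) (use that alpha gamma(1) in simp)
    also have "(3 * \<alpha> / 2 * (4 * \<alpha> + 1) * \<gamma>\<^sup>2 * \<sigma>2) / (\<alpha> * \<gamma> * \<mu>b / 2) = 3 * (4 * \<alpha> + 1) * \<gamma> * \<sigma>2 / \<mu>b"
      using that alpha gamma(1) by (simp add: divide_simps power2_eq_square)
    finally show ?thesis unfolding e_start .
  qed
  have sublinear: "1 / (real K + 1) * (\<Sum>k=0..K. h k)
      \<le> 2 * (norm (x0 - xs))\<^sup>2 / (\<alpha> * \<gamma>\<^sup>2 * (real K + 1)) + 3 * (4 * \<alpha> + 1) * \<sigma>2"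
    if "\<alpha> \<le> 1 / 4" "\<mu>b = 0" for K
  proof -
    define a where "a = \<alpha> * \<gamma>\<^sup>2"
    have a: "0 < a" using alpha gamma(1) by (simp add: a_def)
    have "(\<Sum>k=0..K. 1 / 2 * a * h k) \<le> e 0 + (real K + 1) * (3 / 2 * (4 * \<alpha> + 1) * a * \<sigma>2)"
    proof (rule telescoped_sum_bound[where e = e, OF _ e0])
      show "e (Suc k) + 1 / 2 * a * h k \<le> e k + 3 / 2 * (4 * \<alpha> + 1) * a * \<sigma>2" for k
        using step[OF that(1), of k] that(2) by (simp add: a_def algebra_simps add_divide_distrib)
    qed
    then have "1 / 2 * a * (\<Sum>k=0..K. h k) \<le> e 0 + (real K + 1) * (3 / 2 * (4 * \<alpha> + 1) * a * \<sigma>2)"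
      by (simp add: sum_distrib_left)
    moreover define N where "N = real K + 1"
    ultimately have le: "1 / 2 * a * (\<Sum>k=0..K. h k) * (2 / (a * N))
        \<le> (e 0 + N * (3 / 2 * (4 * \<alpha> + 1) * a * \<sigma>2)) * (2 / (a * N))"
      using a by (intro mult_right_mono) auto
    have N: "0 < N" by (simp add: N_def)
    have "1 / 2 * a * (\<Sum>k=0..K. h k) * (2 / (a * N)) = 1 / N * (\<Sum>k=0..K. h k)"
      using a N by simp
    moreover have "(e 0 + N * (3 / 2 * (4 * \<alpha> + 1) * a * \<sigma>2)) * (2 / (a * N))
        = 2 * e 0 / (a * N) + 3 * (4 * \<alpha> + 1) * \<sigma>2"
      using a N by (simp add: field_simps)
    ultimately have "1 / N * (\<Sum>k=0..K. h k) \<le> 2 * e 0 / (a * N) + 3 * (4 * \<alpha> + 1) * \<sigma>2"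
      using le by linarith
    then show ?thesis unfolding a_def N_def e_start .
  qed
  show ?thesis
    using unified rec linear sublinear
    unfolding e_def h_def H_def avg_def c_def \<sigma>2_def \<mu>b_def by simp
qed

end
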